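(* Let $\mathbb{X}\subseteq\mathbb{R}^n$, $b\in\mathbb{R}$, $\epsilon\in[0,1)$, let $\ell$ be a positive integer, $\Lambda=\{0,1,\dots,\ell\}$, $\lambda_i=i/\ell$. Let $\pi$ be the joint possibility distribution described in the context, built with the deviation function $\delta(\boldsymbol{a})=\|\boldsymbol{a}-\hat{\boldsymbol{a}}\|_\infty=\max_{j\in[n]}|a_j-\hat a_j|$, so that $$\mathcal{C}(\lambda_i)=\{\boldsymbol{a}\in\mathbb{R}^n:\ \underline{\boldsymbol{a}}(\lambda_i)\le\boldsymbol{a}\le\overline{\boldsymbol{a}}(\lambda_i),\ \|\boldsymbol{a}-\hat{\boldsymbol{a}}\|_\infty\le\overline{\delta}(\lambda_i)\},\quad i\in\Lambda.$$ Then for every $\boldsymbol{x}\in\mathbb{X}$ the constraint $$\sup_{\mathrm{P}\in\mathcal{P}^{\ell}_\pi}\mathrm{CVaR}^{\epsilon}_{\mathrm{P}}[\tilde{\boldsymbol{a}}^T\boldsymbol{x}]\le b$$ is equivalent to the following system of linear constraints, i.e. it holds if and only if there exist $w,t\in\mathbb{R}$, $v_i\in\mathbb{R}$ and $\boldsymbol{\alpha}_i,\boldsymbol{\beta}_i,\boldsymbol{\phi}_i,\boldsymbol{\xi}_i,\boldsymbol{\gamma}_i\in\mathbb{R}^n$ ($i\in\Lambda$) such that $$\begin{aligned} & w+\sum_{i\in\Lambda}(\lambda_i-1)v_i\le(b-t)(1-\epsilon),\\ & w-\sum_{j\le i}v_j\ge 0 && \forall i\in\Lambda,\\ & w-\sum_{j\le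 i}v_j+t\ge \overline{\boldsymbol{a}}(\lambda_i)^T\boldsymbol{\alpha}_i-\underline{\boldsymbol{a}}(\lambda_i)^T\boldsymbol{\beta}_i+\hat{\boldsymbol{a}}^T(\boldsymbol{\phi}_i-\boldsymbol{\xi}_i)+\overline{\delta}(\lambda_i)\boldsymbol{1}^T\boldsymbol{\gamma}_i && \forall i\in\Lambda,\\ & \alpha_{ij}-\beta_{ij}+\phi_{ij}-\xi_{ij}=x_j && \forall j\in[n],\ \forall i\in\Lambda,\\ & \gamma_{ij}-\phi_{ij}-\xi_{ij}\ge 0 && \forall j\in[n],\ \forall i\in\Lambda,\\ & \boldsymbol{\alpha}_i,\boldsymbol{\beta}_i,\boldsymbol{\phi}_i,\boldsymbol{\xi}_i,\boldsymbol{\gamma}_i\in\mathbb{R}^n_+ && \forall i\in\Lambda,\\ & v_i\ge 0 && \forall i\in\Lambda, \end{aligned}$$ where $\sum_{j\le i}$ denotes summation over $j\in\{0,\dots,i\}$ and $\boldsymbol{1}=(1,\dots,1)^T$.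
   Context: Notation: $[n]=\{1,\dots,n\}$. For $\epsilon\in[0,1)$ and a real random variable $\mathrm{X}$, $\mathrm{CVaR}^{\epsilon}_{\mathrm{P}}[\mathrm{X}]=\inf_{t\in\mathbb{R}}\big(t+\frac{1}{1-\epsilon}\mathbb{E}_{\mathrm{P}}[[\mathrm{X}-t]_+]\big)$ with $[y]_+=\max\{0,y\}$. Joint possibility distribution. Given are $\hat{\boldsymbol{a}}=(\hat a_1,\dots,\hat a_n)\in\mathbb{R}^n$ (nominal scenario), deviations $\underline{a}_j,\overline{a}_j>0$ ($j\in[n]$) and a budget $\overline{\delta}>0$. For each $j\in[n]$, $\pi_{\tilde a_j}:\mathbb{R}\to[0,1]$ is continuous, equals $1$ at $\hat a_j$, is strictly increasing on $[\hat a_j-\underline{a}_j,\hat a_j]$, strictly decreasing on $[\hat a_j,\hat a_j+\overline{a}_j]$, and equals $0$ outside $[\hat a_j-\underline{a}_j,\hat a_j+\overline{a}_j]$. The function $\pi_{\tilde\delta}:[0,\infty)\to[0,1]$ is continuous, $\pi_{\tilde\delta}(0)=1$, strictly decreasing on $[0,\overline{\delta}]$, and $0$ on $[\overline{\delta},\infty)$. Set $$\pi(\boldsymbol{a})=\min\{\pi_{\tilde a_1}(a_1),\dots,\pi_{\tilde a_n}(a_n),\pi_{\tilde\delta}(\delta(\boldsymbol{a}))\}.$$ For $\lambda\in(0,1]$, $[\underline{a}_j(\lambda),\overline{a}_j(\lambda)]=\{y:\pi_{\tilde a_j}(y)\ge\lambda\}$ and $[0,\overline{\delta}(\lambda)]=\{y\ge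 0:\pi_{\tilde\delta}(y)\ge\lambda\}$; for $\lambda=0$, $\underline{a}_j(0)=\hat a_j-\underline{a}_j$, $\overline{a}_j(0)=\hat a_j+\overline{a}_j$, $\overline{\delta}(0)=\overline{\delta}$. (For example, for $\pi_{\tilde a_j}(y)=(1+\frac{y-\hat a_j}{\underline a_j})^{1/z_1}$ to the left and $(1+\frac{\hat a_j-y}{\overline a_j})^{1/z_2}$ to the right of $\hat a_j$ within its support, and $\pi_{\tilde\delta}(y)=(1-y/\overline\delta)^{1/z}$ on $[0,\overline\delta]$, with $z_1,z_2,z>0$, one has $\underline a_j(\lambda)=\hat a_j-\underline a_j(1-\lambda^{z_1})$, $\overline a_j(\lambda)=\hat a_j+\overline a_j(1-\lambda^{z_2})$, $\overline\delta(\lambda)=\overline\delta(1-\lambda^{z})$.) Write $\underline{\boldsymbol{a}}(\lambda)=(\underline{a}_j(\lambda))_{j\in[n]}$, $\overline{\boldsymbol{a}}(\lambda)=(\overline{a}_j(\lambda))_{j\in[n]}$. The confidence sets are $\mathcal{C}(\lambda)=\{\boldsymbol{a}:\pi(\boldsymbol{a})\ge\lambda\}=\{\boldsymbol{a}:\underline{\boldsymbol{a}}(\lambda)\le\boldsymbol{a}\le\overline{\boldsymbol{a}}(\lambda),\ \delta(\boldsymbol{a})\le\overline{\delta}(\lambda)\}$ for $\lambda\in(0,1]$ and $\mathcal{C}(0)=\{\boldsymbol{a}:\underline{\boldsymbol{a}}(0)\le\boldsymbol{a}\le\overline{\boldsymbol{a}}(0),\ \delta(\boldsymbol{a})\le\overline{\delta}\}=\mathcal{U}$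 (scenario set). Ambiguity set: $\mathcal{P}^{\ell}_\pi$ is the set of all Borel probability distributions $\mathrm{P}$ on $\mathcal{U}$ with $\mathrm{P}(\mathcal{C}(\lambda_i))\ge 1-\lambda_i$ for all $i\in\Lambda$; $\tilde{\boldsymbol{a}}$ is the random vector with distribution $\mathrm{P}$. *)

theory Defs
  imports "HOL-Probability.Probability_Measure"
begin

text \<open>
  A possibility distribution of one uncertain coefficient with nominal value \<open>c\<close> and
  deviations \<open>l\<close> (downwards) and \<open>u\<close> (upwards).
\<close>

definition coeff_possibility :: "real \<Rightarrow> real \<Rightarrow> real \<Rightarrow> (real \<Rightarrow> real) \<Rightarrow> bool" where
  "coeff_possibility c l u p \<longleftrightarrow>
     range p \<subseteq> {0..1} \<and> continuous_on UNIV p \<and> p c = 1 \<and>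
     strict_mono_on {c - l..c} p \<and> strict_antimono_on {c..c + u} p \<and>
     (\<forall>y. y \<notin> {c - l..c + u} \<longrightarrow> p y = 0)"

text \<open>
  The possibility distribution of the deviation is a function on \<open>{0..}\<close>; its values at
  negative arguments are irrelevant.
\<close>

definition deviation_possibility :: "real \<Rightarrow> (real \<Rightarrow> real) \<Rightarrow> bool" where
  "deviation_possibility D q \<longleftrightarrow>
     q ` {0..} \<subseteq> {0..1} \<and> continuous_on {0..} q \<and> q 0 = 1 \<and>
     strict_antimono_on {0..D} q \<and> (\<forall>y\<ge>D. q y = 0)"

definition joint_possibility ::
    "('n \<Rightarrow> real \<Rightarrow> real) \<Rightarrow> (real \<Rightarrow> real) \<Rightarrow> (real ^ 'n \<Rightarrow> real) \<Rightarrow> real ^ 'n \<Rightarrow> real" where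
  "joint_possibility p q \<delta> a = min (MIN j. p j (a $ j)) (q (\<delta> a))"

text \<open>
  End points of the cuts \<open>{y. \<mu> \<le> p y}\<close> and \<open>{y. 0 \<le> y \<and> \<mu> \<le> q y}\<close> for \<open>0 < \<mu> \<le> 1\<close>, which are
  compact intervals (lemmas \<open>coeff_cut_eq\<close> and \<open>deviation_cut_eq\<close> below); the level \<open>0\<close> is
  fixed separately by convention.
\<close>

definition lower_cut :: "real ^ 'n \<Rightarrow> real ^ 'n \<Rightarrow> ('n \<Rightarrow> real \<Rightarrow> real) \<Rightarrow> real \<Rightarrow> real ^ 'n" where
  "lower_cut c l p \<mu> = (\<chi> j. (if \<mu> = 0 then c $ j - l $ j else Inf {y. \<mu> \<le> p j y}))"

definition upper_cut :: "real ^ 'n \<Rightarrow> real ^ 'n \<Rightarrow> ('n \<Rightarrow> real \<Rightarrow> real) \<Rightarrow> real \<Rightarrow> real ^ 'n" where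
  "upper_cut c u p \<mu> = (\<chi> j. (if \<mu> = 0 then c $ j + u $ j else Sup {y. \<mu> \<le> p j y}))"

definition deviation_cut :: "real \<Rightarrow> (real \<Rightarrow> real) \<Rightarrow> real \<Rightarrow> real" where
  "deviation_cut D q \<mu> = (if \<mu> = 0 then D else Sup {y. 0 \<le> y \<and> \<mu> \<le> q y})"

text \<open>The confidence set at level \<open>0\<close> is the scenario set, not the trivial set \<open>{a. 0 \<le> \<dots>}\<close>.\<close>

definition confidence_set ::
    "real ^ 'n \<Rightarrow> real ^ 'n \<Rightarrow> real ^ 'n \<Rightarrow> real \<Rightarrow> ('n \<Rightarrow> real \<Rightarrow> real) \<Rightarrow> (real \<Rightarrow> real) \<Rightarrow>
     (real ^ 'n \<Rightarrow> real) \<Rightarrow> real \<Rightarrow> (real ^ 'n) set" where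
  "confidence_set c l u D p q \<delta> \<mu> =
     (if \<mu> = 0
      then {a. lower_cut c l p 0 \<le> a \<and> a \<le> upper_cut c u p 0 \<and> \<delta> a \<le> D}
      else {a. \<mu> \<le> joint_possibility p q \<delta> a})"

definition level :: "nat \<Rightarrow> nat \<Rightarrow> real" where
  "level L i = real i / real L"

text \<open>
  Borel probability distributions on the scenario set \<open>C 0\<close>. The random vector is the identity
  on \<open>C 0\<close>.
\<close>

definition ambiguity_set :: "nat \<Rightarrow> (real \<Rightarrow> (real ^ 'n) set) \<Rightarrow> (real ^ 'n) measure set" where
  "ambiguity_set L C =
     {P. prob_space P \<and> sets P = sets (restrict_space borel (C 0)) \<and>
         (\<forall>i\<in>{0..L}. measure P (C (level L i)) \<ge> 1 - level L i)}"

text \<open>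
  For \<open>0 \<le> \<epsilon> < 1\<close> and integrable \<open>X\<close> the infimum is over a set bounded below by the mean of \<open>X\<close>.
\<close>

definition CVaR :: "real \<Rightarrow> 'a measure \<Rightarrow> ('a \<Rightarrow> real) \<Rightarrow> real" where
  "CVaR \<epsilon> P X = (INF t. t + 1 / (1 - \<epsilon>) * (LINT \<omega>|P. max 0 (X \<omega> - t)))"

lemma interval_cut:
  fixes f :: "real \<Rightarrow> real"
  assumes S: "S = {y \<in> A. \<mu> \<le> f y}" and A: "closed A" "is_interval A"
    and cont: "continuous_on A f" and c: "c \<in> S" and bdd: "S \<subseteq> {r..s}"
    and inc: "mono_on {r..c} f" and dec: "antimono_on {c..s} f"
  shows "S = {Inf S..Sup S}"
proof -
  have "closed S"
    unfolding S using continuous_closed_preimage[OF cont A(1), of "{\<mu>..}"]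
    by (simp add: vimage_def Int_def)
  then have "compact S"
    using bdd by (meson bounded_closed_interval bounded_subset compact_eq_bounded_closed)
  moreover have "is_interval S"
    unfolding is_interval_1
  proof (intro ballI allI impI)
    fix a b x assume ab: "a \<in> S" "b \<in> S" and x: "a \<le> x \<and> x \<le> b"
    then have xA: "x \<in> A"
      using A(2) unfolding S is_interval_1 by blast
    have "\<mu> \<le> f x"
    proof (cases "x \<le> c")
      case True
      then have "f a \<le> f x"
        using monotone_onD[OF inc, of a x] ab bdd x by fastforce
      then show ?thesis using ab S by auto
    next
      case False
      then have "f b \<le> f x"
        using monotone_onD[OF dec, of x b] ab bdd x by fastforce
      then show ?thesis using ab S by auto
    qed
    then show "x \<in> S" using xA S by simp
  qed
  ultimately obtain a b where ab: "S = {a..b}"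
    by (metis connected_compact_interval_1 is_interval_connected_1)
  then have "a \<le> b" using c by auto
  then show ?thesis using ab by simp
qed

lemma coeff_cut_eq:
  assumes p: "coeff_possibility (c $ j) (l $ j) (u $ j) (p j)" and \<mu>: "0 < \<mu>" "\<mu> \<le> 1"
  shows "{y. \<mu> \<le> p j y} = {lower_cut c l p \<mu> $ j..upper_cut c u p \<mu> $ j}"
proof -
  have "{y. \<mu> \<le> p j y} = {Inf {y. \<mu> \<le> p j y}..Sup {y. \<mu> \<le> p j y}}"
  proof (rule interval_cut[where A = UNIV and c = "c $ j" and f = "p j"
        and r = "c $ j - l $ j" and s = "c $ j + u $ j" and \<mu> = \<mu>])
    show "{y. \<mu> \<le> p j y} \<subseteq> {c $ j - l $ j..c $ j + u $ j}"
    proof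
      fix y assume "y \<in> {y. \<mu> \<le> p j y}"
      then have "p j y \<noteq> 0" using \<mu> by auto
      then show "y \<in> {c $ j - l $ j..c $ j + u $ j}"
        using p unfolding coeff_possibility_def by blast
    qed
    show "mono_on {c $ j - l $ j..c $ j} (p j)"
      using p unfolding coeff_possibility_def by (simp add: strict_mono_on_imp_mono_on)
    show "antimono_on {c $ j..c $ j + u $ j} (p j)"
      using p unfolding coeff_possibility_def monotone_on_def by (metis order_le_less)
  qed (use p \<mu> in \<open>auto simp: coeff_possibility_def\<close>)
  then show ?thesis using \<mu> by (simp add: lower_cut_def upper_cut_def)
qed

lemma deviation_cut_eq:
  assumes q: "deviation_possibility D q" and \<mu>: "0 < \<mu>" "\<mu> \<le> 1"
  shows "{y. 0 \<le> y \<and> \<mu> \<le> q y} = {0..deviation_cut D q \<mu>}"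
proof -
  let ?S = "{y. 0 \<le> y \<and> \<mu> \<le> q y}"
  have eq: "?S = {Inf ?S..Sup ?S}"
  proof (rule interval_cut[where A = "{0..}" and c = 0 and f = q
        and r = 0 and s = D and \<mu> = \<mu>])
    show "?S \<subseteq> {0..D}"
    proof
      fix y assume y: "y \<in> ?S"
      then have "q y \<noteq> 0" using \<mu> by auto
      then have "\<not> D \<le> y"
        using q unfolding deviation_possibility_def by blast
      then show "y \<in> {0..D}" using y by simp
    qed
    show "antimono_on {0..D} q"
      using q unfolding deviation_possibility_def monotone_on_def by (metis order_le_less)
    show "mono_on {0..0} q" by (simp add: monotone_on_def)
  qed (use q \<mu> in \<open>auto simp: deviation_possibility_def is_interval_ci\<close>)
  have "0 \<in> ?S" using q \<mu> by (simp add: deviation_possibility_def)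
  then have "Inf ?S = 0" by (intro cInf_eq_minimum) auto
  then show ?thesis using eq \<mu> by (simp add: deviation_cut_def)
qed

lemma confidence_set_eq:
  assumes p: "\<And>j. coeff_possibility (c $ j) (l $ j) (u $ j) (p j)"
    and q: "deviation_possibility D q" and \<delta>: "\<And>a. 0 \<le> \<delta> a" and \<mu>: "0 \<le> \<mu>" "\<mu> \<le> 1"
  shows "confidence_set c l u D p q \<delta> \<mu> =
    {a. lower_cut c l p \<mu> \<le> a \<and> a \<le> upper_cut c u p \<mu> \<and> \<delta> a \<le> deviation_cut D q \<mu>}"
proof (cases "\<mu> = 0")
  case True
  then show ?thesis by (simp add: confidence_set_def deviation_cut_def)
next
  case False
  then have "0 < \<mu>" using \<mu> by simp
  have "\<mu> \<le> p j y \<longleftrightarrow> lower_cut c l p \<mu> $ j \<le> y \<and> y \<le> upper_cut c u p \<mu> $ j" for j y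
    using coeff_cut_eq[of c j l u p \<mu>] p[of j] \<open>0 < \<mu>\<close> \<mu>(2) by (simp add: set_eq_iff)
  moreover have "\<mu> \<le> q (\<delta> a) \<longleftrightarrow> \<delta> a \<le> deviation_cut D q \<mu>" for a
    using deviation_cut_eq[OF q \<open>0 < \<mu>\<close> \<mu>(2)] \<delta>[of a] by (auto simp: set_eq_iff)
  ultimately show ?thesis
    using False by (auto simp: confidence_set_def joint_possibility_def less_eq_vec_def)
qed

end

theory Submission
  imports Defs
begin

section \<open>Linear programming duality over a box intersected with a sup-norm ball\<close>

lemma infnorm_le_iff_cart:
  fixes x :: "real ^ 'n"
  shows "infnorm x \<le> r \<longleftrightarrow> (\<forall>j. \<bar>x $ j\<bar> \<le> r)"
  by (auto simp: infnorm_Max Basis_vec_def inner_axis)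

text \<open>
  The box cut by the sup-norm ball is again a box, so its linear program splits into one program
  per coordinate; the optimal dual solution puts \<open>\<bar>x $ j\<bar>\<close> on the tighter of the two bounds that
  act in the direction of the sign of \<open>x $ j\<close>.
\<close>

lemma box_infnorm_lp_duality:
  fixes x c l u :: "real ^ 'n" and d z :: real
  assumes "l \<le> c" "c \<le> u" "0 \<le> d"
  shows "(\<forall>a. l \<le> a \<and> a \<le> u \<and> infnorm (a - c) \<le> d \<longrightarrow> a \<bullet> x \<le> z) \<longleftrightarrow>
    (\<exists>\<alpha> \<beta> \<phi> \<xi> \<gamma>. u \<bullet> \<alpha> - l \<bullet> \<beta> + c \<bullet> (\<phi> - \<xi>) + d * (1 \<bullet> \<gamma>) \<le> z \<and>
       (\<forall>j. \<alpha> $ j - \<beta> $ j + \<phi> $ j - \<xi> $ j = x $ j) \<and>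
       (\<forall>j. \<gamma> $ j - \<phi> $ j - \<xi> $ j \<ge> 0) \<and>
       0 \<le> \<alpha> \<and> 0 \<le> \<beta> \<and> 0 \<le> \<phi> \<and> 0 \<le> \<xi> \<and> 0 \<le> \<gamma>)" (is "?primal \<longleftrightarrow> ?dual")
proof
  assume primal: ?primal
  define \<alpha> :: "real ^ 'n" where "\<alpha> = (\<chi> j. if 0 \<le> x $ j \<and> u $ j \<le> c $ j + d then x $ j else 0)"
  define \<phi> :: "real ^ 'n" where "\<phi> = (\<chi> j. if 0 \<le> x $ j \<and> \<not> u $ j \<le> c $ j + d then x $ j else 0)"
  define \<beta> :: "real ^ 'n" where "\<beta> = (\<chi> j. if \<not> 0 \<le> x $ j \<and> c $ j - d \<le> l $ j then - x $ j else 0)"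
  define \<xi> :: "real ^ 'n" where "\<xi> = (\<chi> j. if \<not> 0 \<le> x $ j \<and> \<not> c $ j - d \<le> l $ j then - x $ j else 0)"
  \<comment> \<open>The primal maximizer: each coordinate goes as far as both bounds allow in the
    direction of the sign of \<open>x $ j\<close>. It is feasible because \<open>c\<close> lies in
    the box and \<open>d\<close> is nonnegative.\<close>
  define a :: "real ^ 'n" where
    "a = (\<chi> j. if 0 \<le> x $ j then min (u $ j) (c $ j + d) else max (l $ j) (c $ j - d))"
  have box: "l $ j \<le> c $ j" "c $ j \<le> u $ j" for j
    using assms by (auto simp: less_eq_vec_def)
  have "l $ j \<le> a $ j \<and> a $ j \<le> u $ j \<and> \<bar>a $ j - c $ j\<bar> \<le> d" for j
    using box[of j] assms(3) by (auto simp: a_def)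
  then have "l \<le> a \<and> a \<le> u \<and> infnorm (a - c) \<le> d"
    by (simp add: less_eq_vec_def infnorm_le_iff_cart)
  then have "a \<bullet> x \<le> z"
    using primal by blast
  \<comment> \<open>Primal and dual values agree coordinate by coordinate. Here
    \<open>\<gamma>\<close> is taken as \<open>\<phi> + \<xi>\<close>, the smallest choice that its
    constraint permits, hence the cheapest since \<open>0 \<le> d\<close>.\<close>
  moreover have "u \<bullet> \<alpha> - l \<bullet> \<beta> + c \<bullet> (\<phi> - \<xi>) + d * (1 \<bullet> (\<phi> + \<xi>)) = a \<bullet> x"
    unfolding inner_vec_def sum_distrib_left sum_subtractf[symmetric] sum.distrib[symmetric]
    by (intro sum.cong) (auto simp: \<alpha>_def \<beta>_def \<phi>_def \<xi>_def a_def algebra_simps)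
  moreover have "\<alpha> $ j - \<beta> $ j + \<phi> $ j - \<xi> $ j = x $ j" for j
    by (simp add: \<alpha>_def \<beta>_def \<phi>_def \<xi>_def)
  moreover have "0 \<le> \<alpha>" "0 \<le> \<beta>" "0 \<le> \<phi>" "0 \<le> \<xi>"
    by (simp_all add: \<alpha>_def \<beta>_def \<phi>_def \<xi>_def less_eq_vec_def)
  ultimately show ?dual
    by (intro exI[of _ \<alpha>] exI[of _ \<beta>] exI[of _ \<phi>] exI[of _ \<xi>] exI[of _ "\<phi> + \<xi>"])
      (simp add: less_eq_vec_def)
next
  assume ?dual
  then obtain \<alpha> \<beta> \<phi> \<xi> \<gamma> where le: "u \<bullet> \<alpha> - l \<bullet> \<beta> + c \<bullet> (\<phi> - \<xi>) + d * (1 \<bullet> \<gamma>) \<le> z"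
    and x: "\<And>j. \<alpha> $ j - \<beta> $ j + \<phi> $ j - \<xi> $ j = x $ j"
    and \<gamma>: "\<And>j. \<gamma> $ j - \<phi> $ j - \<xi> $ j \<ge> 0"
    and nonneg: "\<And>j. 0 \<le> \<alpha> $ j" "\<And>j. 0 \<le> \<beta> $ j" "\<And>j. 0 \<le> \<phi> $ j" "\<And>j. 0 \<le> \<xi> $ j"
    by (auto simp: less_eq_vec_def)
  show ?primal
  proof (intro allI impI)
    fix a assume "l \<le> a \<and> a \<le> u \<and> infnorm (a - c) \<le> d"
    then have a: "l $ j \<le> a $ j" "a $ j \<le> u $ j" "\<bar>a $ j - c $ j\<bar> \<le> d" for j
      by (auto simp: less_eq_vec_def infnorm_le_iff_cart)
    have "a \<bullet> x \<le> u \<bullet> \<alpha> - l \<bullet> \<beta> + c \<bullet> (\<phi> - \<xi>) + d * (1 \<bullet> \<gamma>)"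
      unfolding inner_vec_def sum_distrib_left sum_subtractf[symmetric] sum.distrib[symmetric]
    proof (rule sum_mono)
      fix j
      \<comment> \<open>Weak duality: substituting the equality constraint for \<open>x $ j\<close>
        splits \<open>a $ j * x $ j\<close> into four terms. The box bounds control those with
        \<open>\<alpha>\<close> and \<open>\<beta>\<close>, the ball those with
        \<open>\<phi>\<close> and \<open>\<xi>\<close>, and \<open>\<gamma>\<close> dominates
        \<open>\<phi> + \<xi>\<close>.\<close>
      have "a $ j * \<alpha> $ j \<le> u $ j * \<alpha> $ j" "l $ j * \<beta> $ j \<le> a $ j * \<beta> $ j"
        "(a $ j - c $ j) * \<phi> $ j \<le> d * \<phi> $ j" "(c $ j - a $ j) * \<xi> $ j \<le> d * \<xi> $ j"
        "d * (\<phi> $ j + \<xi> $ j) \<le> d * \<gamma> $ j"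
        using a[of j] nonneg[of j] \<gamma>[of j] assms(3)
        by (auto intro!: mult_right_mono mult_left_mono)
      then show "a $ j \<bullet> x $ j \<le>
          u $ j \<bullet> \<alpha> $ j - l $ j \<bullet> \<beta> $ j + c $ j \<bullet> (\<phi> - \<xi>) $ j + d * (1 $ j \<bullet> \<gamma> $ j)"
        unfolding x[of j, symmetric] by (simp add: algebra_simps)
    qed
    then show "a \<bullet> x \<le> z"
      using le by simp
  qed
qed

section \<open>Infima over the threshold in CVaR\<close>

text \<open>A real infimum lies below a given value of the objective only if the range is known to
  be bounded below. The mean of \<open>X\<close> is such a bound: the positive part dominates
  \<open>X - s\<close>, and the factor \<open>1 / (1 - \<epsilon>)\<close> is at least 1.\<close>

lemma CVaR_le:
  assumes P: "prob_space P" and X: "integrable P X" and \<epsilon>: "0 \<le> \<epsilon>" "\<epsilon> < 1"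
    and b: "t + 1 / (1 - \<epsilon>) * (LINT \<omega>|P. max 0 (X \<omega> - t)) \<le> b"
  shows "CVaR \<epsilon> P X \<le> b"
  unfolding CVaR_def
proof (rule cINF_lower2)
  interpret prob_space P by (rule P)
  have "(LINT \<omega>|P. X \<omega>) \<le> s + 1 / (1 - \<epsilon>) * (LINT \<omega>|P. max 0 (X \<omega> - s))" for s
  proof -
    have int: "integrable P (\<lambda>\<omega>. max 0 (X \<omega> - s))"
      using X by simp
    have "(LINT \<omega>|P. X \<omega>) - s = (LINT \<omega>|P. X \<omega> - s)"
      using X prob_space by simp
    also have "\<dots> \<le> 1 * (LINT \<omega>|P. max 0 (X \<omega> - s))"
      unfolding mult_1 by (rule integral_mono) (use X int in auto)
    also have "\<dots> \<le> 1 / (1 - \<epsilon>) * (LINT \<omega>|P. max 0 (X \<omega> - s))"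
      using \<epsilon> by (intro mult_right_mono integral_nonneg_AE) auto
    finally show ?thesis by simp
  qed
  then show "bdd_below (range (\<lambda>t. t + 1 / (1 - \<epsilon>) * (LINT \<omega>|P. max 0 (X \<omega> - t))))"
    by (intro bdd_belowI2)
qed (use b in auto)

text \<open>Left of all \<open>M i\<close> the objective has slope \<open>1 - k \<le> 0\<close>,
  right of all of them slope 1, so a minimizer over the compact interval between the extreme values
  is a global one. Attainment turns a bound on the infimum into a single threshold \<open>t\<close>
  satisfying the same bound.\<close>

lemma average_excess_attains_inf:
  fixes M :: "nat \<Rightarrow> real"
  assumes "0 < L" "1 \<le> k"
  shows "\<exists>t. \<forall>s. t + k * ((\<Sum>i<L. max 0 (M i - t)) / L) \<le> s + k * ((\<Sum>i<L. max 0 (M i - s)) / L)"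
proof -
  define F where "F t = t + k * ((\<Sum>i<L. max 0 (M i - t)) / L)" for t
  define m M' where "m = Min (M ` {..<L})" and "M' = Max (M ` {..<L})"
  have m: "m \<le> M i" and M': "M i \<le> M'" if "i < L" for i
    using that by (auto simp: m_def M'_def)
  have "m \<le> M'"
    using m[OF assms(1)] M'[OF assms(1)] by simp
  moreover have "continuous_on {m..M'} F"
    unfolding F_def by (intro continuous_intros) (use assms in auto)
  ultimately obtain t where t: "t \<in> {m..M'}" and inf: "\<And>s. s \<in> {m..M'} \<Longrightarrow> F t \<le> F s"
    using continuous_attains_inf[of "{m..M'}" F] by auto
  have "F t \<le> F s" for s
  proof -
    consider "s < m" | "M' < s" | "s \<in> {m..M'}" by fastforce
    then show ?thesis
    proof cases
      case 1
      \<comment> \<open>Below \<open>m\<close> every positive part is active, so moving the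
        threshold from \<open>m\<close> down to \<open>s\<close> raises each summand by exactly
        \<open>m - s\<close>.\<close>
      have "(\<Sum>i<L. max 0 (M i - s)) = (\<Sum>i<L. max 0 (M i - m) + (m - s))"
        using 1 m by (intro sum.cong) (fastforce simp: max_def)+
      also have "\<dots> = (\<Sum>i<L. max 0 (M i - m)) + L * (m - s)"
        unfolding sum.distrib by simp
      finally have avg: "(\<Sum>i<L. max 0 (M i - s)) / L = (\<Sum>i<L. max 0 (M i - m)) / L + (m - s)"
        using assms(1) by (simp add: add_divide_distrib)
      have "F s = F m + (k - 1) * (m - s)"
        unfolding F_def avg by (simp add: algebra_simps)
      then have "F m \<le> F s"
        using 1 assms(2) by simp
      then show ?thesis using inf[of m] \<open>m \<le> M'\<close> by simp
    next
      case 2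
      have "(\<Sum>i<L. max 0 (M i - M')) = 0"
        using M' by (intro sum.neutral) auto
      then have "F M' = M'"
        by (simp add: F_def)
      also have "\<dots> \<le> F s"
        unfolding F_def using 2 assms by (smt (verit) divide_nonneg_nonneg mult_nonneg_nonneg of_nat_0_le_iff sum_nonneg)
      finally show ?thesis using inf[of M'] \<open>m \<le> M'\<close> by simp
    qed (rule inf)
  qed
  then show ?thesis unfolding F_def by blast
qed

section \<open>Worst-case CVaR and the multipliers of the probability constraints\<close>

text \<open>Summation by parts for the decrements \<open>v\<close> of \<open>s\<close>. Keeping
  \<open>K\<close> separate from \<open>n\<close> leaves the weights fixed during the induction; at
  \<open>K = n\<close> the boundary term at \<open>n\<close> vanishes.\<close>

lemma sum_linear_weights_by_parts:
  fixes s v :: "nat \<Rightarrow> real" and K :: real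
  assumes "v 0 = 0" "\<And>i. v (Suc i) = s i - s (Suc i)"
  shows "(\<Sum>i\<in>{0..n}. (real i - K) * v i) = (\<Sum>i<n. s i) + (K - real n) * s n - K * s 0"
  by (induction n) (simp_all add: assms algebra_simps)

text \<open>
  The worst-case distribution is uniform on maximizers of \<open>f\<close> over \<open>C (level L i)\<close>, \<open>i < L\<close>. For
  the other direction, the multipliers give the pointwise bound of \<open>max 0 (f - t)\<close> by
  \<open>w - (\<Sum>i\<le>L. v i * indicator (C (level L i)))\<close>.
\<close>

lemma SUP_CVaR_ambiguity_set_le_iff:
  fixes C :: "real \<Rightarrow> (real ^ 'n) set" and f :: "real ^ 'n \<Rightarrow> real"
  assumes \<epsilon>: "0 \<le> \<epsilon>" "\<epsilon> < 1" and L: "0 < L"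
    and comp: "\<And>i. i \<le> L \<Longrightarrow> compact (C (level L i))"
    and ne: "\<And>i. i \<le> L \<Longrightarrow> C (level L i) \<noteq> {}"
    and nested: "\<And>i k. i \<le> k \<Longrightarrow> k \<le> L \<Longrightarrow> C (level L k) \<subseteq> C (level L i)"
    and f: "continuous_on UNIV f"
  shows "(SUP P\<in>ambiguity_set L C. ereal (CVaR \<epsilon> P f)) \<le> ereal b \<longleftrightarrow>
    (\<exists>w t (v :: nat \<Rightarrow> real). w + (\<Sum>i\<in>{0..L}. (level L i - 1) * v i) \<le> (b - t) * (1 - \<epsilon>) \<and>
       (\<forall>i\<in>{0..L}. w - (\<Sum>j\<in>{0..i}. v j) \<ge> 0) \<and>
       (\<forall>i\<in>{0..L}. \<forall>a\<in>C (level L i). f a \<le> w - (\<Sum>j\<in>{0..i}. v j) + t) \<and>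
       (\<forall>i\<in>{0..L}. v i \<ge> 0))" (is "?sup \<longleftrightarrow> ?system")
proof -
  have level0: "level L 0 = 0" by (simp add: level_def)
  have C0: "compact (C 0)" and sub: "\<And>i. i \<le> L \<Longrightarrow> C (level L i) \<subseteq> C 0"
    using comp[of 0] nested[of 0] level0 by auto
  have f_meas: "f \<in> borel_measurable (restrict_space borel (C 0))"
    using f by (intro measurable_restrict_space1 borel_measurable_continuous_onI)
  have C_sets: "C (level L i) \<in> sets (restrict_space borel (C 0))" if "i \<le> L" for i
    using sub[OF that] comp[OF that] C0
    by (simp add: sets_restrict_space_iff compact_imp_closed)
  have "\<exists>a\<in>C (level L i). \<forall>a'\<in>C (level L i). f a' \<le> f a" if "i \<le> L" for i
    using comp[OF that] ne[OF that] f by (blast intro: continuous_attains_sup continuous_on_subset)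
  then obtain A where A: "\<And>i. i \<le> L \<Longrightarrow> A i \<in> C (level L i)"
    and A_max: "\<And>i a. i \<le> L \<Longrightarrow> a \<in> C (level L i) \<Longrightarrow> f a \<le> f (A i)"
    by metis
  show ?thesis
  proof
    assume sup: ?sup
    \<comment> \<open>Pushing the uniform measure on indices forward along \<open>A\<close> adds the
      masses of coinciding maximizers, and expectations become averages over \<open>i < L\<close>.
      Each index has mass \<open>1 / L\<close>, the gap between consecutive levels.\<close>
    define U where "U = uniform_count_measure {..<L}"
    define P where "P = distr U (restrict_space borel (C 0)) A"
    have "prob_space U"
      unfolding U_def using L by (intro prob_space_uniform_count_measure) auto
    have A_meas: "A \<in> measurable U (restrict_space borel (C 0))"
    proof (rule measurableI)
      show "A i \<in> space (restrict_space borel (C 0))" if "i \<in> space U" for i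
        using that A[of i] sub[of i]
        by (auto simp: U_def space_uniform_count_measure space_restrict_space)
    qed (auto simp: U_def space_uniform_count_measure sets_uniform_count_measure)
    have "measure P (C (level L i)) \<ge> 1 - level L i" if i: "i \<in> {0..L}" for i
    proof -
      \<comment> \<open>By nesting, every maximizer with index \<open>k \<ge> i\<close> lies in the
        \<open>i\<close>-th set. These are \<open>L - i\<close> of the \<open>L\<close> indices,
        which gives mass at least \<open>1 - i / L\<close>.\<close>
      have "{i..<L} \<subseteq> A -` C (level L i) \<inter> {..<L}"
      proof
        fix k assume "k \<in> {i..<L}"
        then show "k \<in> A -` C (level L i) \<inter> {..<L}"
          using A[of k] nested[of i k] by auto
      qed
      then have "card {i..<L} \<le> card (A -` C (level L i) \<inter> {..<L})"
        by (intro card_mono) auto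
      then have "real L - real i \<le> card (A -` C (level L i) \<inter> {..<L})"
        using i by (simp flip: of_nat_diff)
      moreover have "measure P (C (level L i)) = card (A -` C (level L i) \<inter> {..<L}) / L"
        using i C_sets A_meas
        by (simp add: P_def measure_distr U_def space_uniform_count_measure measure_uniform_count_measure)
      ultimately show ?thesis
        using L by (simp add: level_def field_simps)
    qed
    then have "P \<in> ambiguity_set L C"
      using prob_space.prob_space_distr[OF \<open>prob_space U\<close> A_meas]
      by (simp add: ambiguity_set_def P_def)
    then have "CVaR \<epsilon> P f \<le> b"
      using sup by (simp add: SUP_le_iff)
    moreover have "(LINT a|P. max 0 (f a - t)) = (\<Sum>i<L. max 0 (f (A i) - t)) / L" for t
      unfolding P_def using A_meas f_meas
      by (subst integral_distr) (auto simp: U_def integral_uniform_count_measure)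
    ultimately have INF: "(INF t. t + 1 / (1 - \<epsilon>) * ((\<Sum>i<L. max 0 (f (A i) - t)) / L)) \<le> b"
      by (simp add: CVaR_def)
    obtain t where "\<And>s. t + 1 / (1 - \<epsilon>) * ((\<Sum>i<L. max 0 (f (A i) - t)) / L) \<le>
        s + 1 / (1 - \<epsilon>) * ((\<Sum>i<L. max 0 (f (A i) - s)) / L)"
      using average_excess_attains_inf[OF L, of "1 / (1 - \<epsilon>)" "\<lambda>i. f (A i)"] \<epsilon> by auto
    then have "t + 1 / (1 - \<epsilon>) * ((\<Sum>i<L. max 0 (f (A i) - t)) / L) \<le>
        (INF t. t + 1 / (1 - \<epsilon>) * ((\<Sum>i<L. max 0 (f (A i) - t)) / L))"
      by (intro cINF_greatest) auto
    from order_trans[OF this INF]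
    have "((\<Sum>i<L. max 0 (f (A i) - t)) / L) / (1 - \<epsilon>) \<le> b - t"
      by (simp add: mult.commute)
    then have t: "(\<Sum>i<L. max 0 (f (A i) - t)) / L \<le> (b - t) * (1 - \<epsilon>)"
      using \<epsilon> by (simp only: pos_divide_le_eq)
    \<comment> \<open>\<open>s i\<close> is the largest excess over \<open>t\<close> on the
      \<open>i\<close>-th set, and \<open>v\<close> records its decrease from one level to the next.
      With \<open>w = s 0\<close> and \<open>v 0 = 0\<close>, the expression
      \<open>w - (\<Sum>j\<in>{0..i}. v j)\<close> telescopes to \<open>s i\<close>.\<close>
    define s where "s i = max 0 (f (A i) - t)" for i
    define v where "v i = (case i of 0 \<Rightarrow> 0 | Suc k \<Rightarrow> s k - s i)" for i
    have v: "v 0 = 0" "\<And>i. v (Suc i) = s i - s (Suc i)"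
      by (simp_all add: v_def)
    have "s (Suc i) \<le> s i" if "Suc i \<le> L" for i
      using that A_max[of i "A (Suc i)"] A[of "Suc i"] nested[of i "Suc i"] by (auto simp: s_def)
    then have v_nonneg: "0 \<le> v i" if "i \<le> L" for i
      using that by (cases i) (auto simp: v)
    have s_eq: "s 0 - (\<Sum>j\<in>{0..i}. v j) = s i" for i
      by (induction i) (simp_all add: v)
    have "s 0 + (\<Sum>i\<in>{0..L}. (level L i - 1) * v i) =
        s 0 + (\<Sum>i\<in>{0..L}. (real i - real L) * v i) / L"
      using L by (simp add: level_def sum_divide_distrib field_simps)
    \<comment> \<open>Summation by parts with both parameters equal to \<open>L\<close> leaves
      \<open>- L * s 0\<close> as the only boundary term; after division by \<open>L\<close> it
      cancels the leading \<open>s 0\<close>.\<close>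
    also have "\<dots> = (\<Sum>i<L. s i) / L"
      using sum_linear_weights_by_parts[of v s "real L" L] v L by (simp add: field_simps)
    finally have "s 0 + (\<Sum>i\<in>{0..L}. (level L i - 1) * v i) \<le> (b - t) * (1 - \<epsilon>)"
      using t by (simp add: s_def)
    moreover have "f a \<le> s i + t" if "i \<le> L" "a \<in> C (level L i)" for i a
      using A_max[OF that] by (simp add: s_def)
    moreover have "0 \<le> s i" for i by (simp add: s_def)
    ultimately show ?system
      using v_nonneg by (intro exI[of _ "s 0"] exI[of _ t] exI[of _ v]) (auto simp: s_eq)
  next
    assume ?system
    then obtain w t v where le: "w + (\<Sum>i\<in>{0..L}. (level L i - 1) * v i) \<le> (b - t) * (1 - \<epsilon>)"
      and pos: "\<And>i. i \<le> L \<Longrightarrow> w - (\<Sum>j\<in>{0..i}. v j) \<ge> 0"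
      and f_le: "\<And>i a. i \<le> L \<Longrightarrow> a \<in> C (level L i) \<Longrightarrow> f a \<le> w - (\<Sum>j\<in>{0..i}. v j) + t"
      and v: "\<And>i. i \<le> L \<Longrightarrow> v i \<ge> 0"
      by fastforce
    have "CVaR \<epsilon> P f \<le> b" if "P \<in> ambiguity_set L C" for P
    proof -
      have P: "prob_space P" and sets: "sets P = sets (restrict_space borel (C 0))"
        and prob: "\<And>i. i \<le> L \<Longrightarrow> measure P (C (level L i)) \<ge> 1 - level L i"
        using that by (auto simp: ambiguity_set_def)
      interpret prob_space P by (rule P)
      have space: "space P = C 0"
        using sets_eq_imp_space_eq[OF sets] by (simp add: space_restrict_space)
      have C_meas: "C (level L i) \<in> sets P" if "i \<le> L" for i
        using C_sets[OF that] sets by simp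
      \<comment> \<open>\<open>P\<close> lives on the compact set \<open>C 0\<close>, where the
        continuous \<open>f\<close> is bounded; hence \<open>f\<close> is integrable.\<close>
      obtain B where B: "\<And>a. a \<in> C 0 \<Longrightarrow> \<bar>f a\<bar> \<le> B"
        using compact_imp_bounded[OF compact_continuous_image[OF continuous_on_subset[OF f] C0]]
        by (auto simp: bounded_iff)
      have int: "integrable P f"
        using B f_meas sets space
        by (intro integrable_const_bound[of _ B]) (auto cong: measurable_cong_sets)
      let ?g = "\<lambda>a. w - (\<Sum>j\<in>{0..L}. v j * indicator (C (level L j)) a)"
      have "max 0 (f a - t) \<le> ?g a" if a: "a \<in> space P" for a
      proof -
        \<comment> \<open>The deepest level whose set contains \<open>a\<close>; it exists because
          \<open>a\<close> lies in \<open>C 0\<close>, the set of level index 0. Beyond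
          \<open>k\<close> all indicators vanish, so \<open>?g a\<close> is at least
          \<open>w - (\<Sum>j\<in>{0..k}. v j)\<close>, which the system bounds below by both 0 and
          \<open>f a - t\<close>.\<close>
        define k where "k = Max {i. i \<le> L \<and> a \<in> C (level L i)}"
        have "{i. i \<le> L \<and> a \<in> C (level L i)} \<noteq> {}"
          using a level0 space by auto
        then have k: "k \<le> L" "a \<in> C (level L k)"
          using Max_in[of "{i. i \<le> L \<and> a \<in> C (level L i)}"] by (auto simp: k_def)
        have k_max: "j \<le> k" if "j \<le> L" "a \<in> C (level L j)" for j
          unfolding k_def using that by (intro Max_ge) auto
        have "(\<Sum>j\<in>{0..L}. v j * indicator (C (level L j)) a) \<le> (\<Sum>j\<in>{0..k}. v j)"
        proof -
          have "(\<Sum>j\<in>{0..L}. v j * indicator (C (level L j)) a) =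
              (\<Sum>j\<in>{0..k}. v j * indicator (C (level L j)) a)"
            using k k_max by (intro sum.mono_neutral_right) (auto simp: indicator_def)
          also have "\<dots> \<le> (\<Sum>j\<in>{0..k}. v j)"
            using k v by (intro sum_mono) (auto simp: indicator_def)
          finally show ?thesis .
        qed
        then show ?thesis using pos[OF k(1)] f_le[OF k] by simp
      qed
      moreover have ind_int: "integrable P (\<lambda>a. v j * indicator (C (level L j)) a)" if "j \<in> {0..L}" for j
        using that C_meas by (intro integrable_mult_right integrable_real_indicator)
          (auto simp: emeasure_finite less_top[symmetric])
      moreover have sum_int: "integrable P (\<lambda>a. \<Sum>j\<in>{0..L}. v j * indicator (C (level L j)) a)"
        using ind_int by (rule Bochner_Integration.integrable_sum)
      ultimately have "(LINT a|P. max 0 (f a - t)) \<le> (LINT a|P. ?g a)"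
        using int by (intro integral_mono Bochner_Integration.integrable_diff) auto
      also have "\<dots> = w - (\<Sum>j\<in>{0..L}. LINT a|P. v j * indicator (C (level L j)) a)"
        unfolding Bochner_Integration.integral_diff[OF integrable_const sum_int]
        using ind_int by (subst Bochner_Integration.integral_sum) (auto simp: prob_space)
      also have "\<dots> = w - (\<Sum>j\<in>{0..L}. v j * measure P (C (level L j)))"
        using C_meas by simp
      \<comment> \<open>The probability constraints of the ambiguity set enter here, weighted by the
        nonnegative multipliers.\<close>
      also have "\<dots> \<le> w - (\<Sum>j\<in>{0..L}. v j * (1 - level L j))"
        using prob v by (intro diff_left_mono sum_mono mult_left_mono) auto
      also have "\<dots> = w + (\<Sum>i\<in>{0..L}. (level L i - 1) * v i)"
        by (simp add: algebra_simps sum_subtractf)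
      also note le
      finally have "t + 1 / (1 - \<epsilon>) * (LINT a|P. max 0 (f a - t)) \<le> b"
        using \<epsilon> by (simp add: field_simps)
      then show ?thesis by (rule CVaR_le[OF P int \<epsilon>])
    qed
    then show ?sup by (intro SUP_least) simp
  qed
qed

section \<open>Nonempty, nested and compact confidence sets\<close>

text \<open>The nominal value has possibility 1 and so belongs to every cut. This supplies the order
  hypotheses of the duality lemma and a point in each confidence set.\<close>

lemma center_mem_cut:
  assumes "coeff_possibility (c $ j) (l $ j) (u $ j) (p j)" "0 < l $ j" "0 < u $ j" "0 \<le> \<mu>" "\<mu> \<le> 1"
  shows "lower_cut c l p \<mu> $ j \<le> c $ j \<and> c $ j \<le> upper_cut c u p \<mu> $ j"
proof (cases "\<mu> = 0")
  case False
  then have "c $ j \<in> {y. \<mu> \<le> p j y}"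
    using assms by (simp add: coeff_possibility_def)
  then show ?thesis
    using coeff_cut_eq[of c j l u p \<mu>] False assms(1,4,5) by simp
qed (use assms in \<open>simp add: lower_cut_def upper_cut_def\<close>)

lemma deviation_cut_nonneg:
  assumes "deviation_possibility D q" "0 < D" "0 \<le> \<mu>" "\<mu> \<le> 1"
  shows "0 \<le> deviation_cut D q \<mu>"
proof (cases "\<mu> = 0")
  case False
  then have "0 \<in> {y. 0 \<le> y \<and> \<mu> \<le> q y}"
    using assms by (simp add: deviation_possibility_def)
  then show ?thesis
    using deviation_cut_eq[OF assms(1)] False assms by simp
qed (use assms in \<open>simp add: deviation_cut_def\<close>)

text \<open>Between positive levels this is transitivity. Only the step to level 0 needs the
  distributions: a positive possibility forces each coordinate into its support and the deviation
  below \<open>D\<close>.\<close>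

lemma confidence_set_antimono:
  fixes c l u :: "real ^ 'n"
  assumes p: "\<And>j. coeff_possibility (c $ j) (l $ j) (u $ j) (p j)"
    and q: "deviation_possibility D q" and "0 \<le> \<mu>" "\<mu> \<le> \<nu>" "\<nu> \<le> 1"
  shows "confidence_set c l u D p q \<delta> \<nu> \<subseteq> confidence_set c l u D p q \<delta> \<mu>"
proof (cases "\<mu> = 0 \<and> \<nu> \<noteq> 0")
  case True
  show ?thesis
  proof
    fix a assume "a \<in> confidence_set c l u D p q \<delta> \<nu>"
    then have "\<And>j. \<nu> \<le> p j (a $ j)" "\<nu> \<le> q (\<delta> a)"
      using True by (auto simp: confidence_set_def joint_possibility_def)
    moreover have "0 < \<nu>"
      using True assms(4) by simp
    ultimately have pos: "\<And>j. 0 < p j (a $ j)" "0 < q (\<delta> a)"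
      by (auto intro: less_le_trans)
    have "a $ j \<in> {c $ j - l $ j..c $ j + u $ j}" for j
      using pos(1)[of j] p[of j] unfolding coeff_possibility_def by (metis less_irrefl)
    moreover have "\<delta> a \<le> D"
      using pos(2) q unfolding deviation_possibility_def by (metis less_irrefl linear)
    ultimately show "a \<in> confidence_set c l u D p q \<delta> \<mu>"
      using True by (simp add: confidence_set_def lower_cut_def upper_cut_def less_eq_vec_def)
  qed
qed (use assms in \<open>auto simp: confidence_set_def\<close>)

lemma compact_box_infnorm:
  fixes l u c :: "real ^ 'n"
  shows "compact {a. l \<le> a \<and> a \<le> u \<and> infnorm (a - c) \<le> d}"
proof -
  have "{a. l \<le> a \<and> a \<le> u \<and> infnorm (a - c) \<le> d} = {l..u} \<inter> {a. infnorm (a - c) \<le> d}"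
    by auto
  moreover have "closed {a. infnorm (a - c) \<le> d}"
    by (intro closed_Collect_le continuous_intros)
  ultimately show ?thesis
    by (simp add: compact_Int_closed compact_interval)
qed

section \<open>Assembly of the linear system\<close>

theorem corollary1:
  fixes X :: "(real ^ 'n) set" and b \<epsilon> :: real and L :: nat
    and ahat adown aup :: "real ^ 'n" and D :: real
    and p :: "'n \<Rightarrow> real \<Rightarrow> real" and q :: "real \<Rightarrow> real"
    and \<delta> :: "real ^ 'n \<Rightarrow> real"
    and lo up :: "nat \<Rightarrow> real ^ 'n" and dev :: "nat \<Rightarrow> real"
  assumes "0 \<le> \<epsilon>" and "\<epsilon> < 1" and "0 < L"
    and "\<And>j. 0 < adown $ j" and "\<And>j. 0 < aup $ j" and "0 < D"
    and "\<And>j. coeff_possibility (ahat $ j) (adown $ j) (aup $ j) (p j)"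
    and "deviation_possibility D q"
  defines "\<delta> \<equiv> \<lambda>a. infnorm (a - ahat)"
    and "lo \<equiv> \<lambda>i. lower_cut ahat adown p (level L i)"
    and "up \<equiv> \<lambda>i. upper_cut ahat aup p (level L i)"
    and "dev \<equiv> \<lambda>i. deviation_cut D q (level L i)"
  shows "\<forall>x\<in>X.
    (SUP P\<in>ambiguity_set L (confidence_set ahat adown aup D p q \<delta>).
        ereal (CVaR \<epsilon> P (\<lambda>a. a \<bullet> x))) \<le> ereal b
    \<longleftrightarrow>
    (\<exists>(w::real) (t::real) (v :: nat \<Rightarrow> real)
      (\<alpha> :: nat \<Rightarrow> real ^ 'n) (\<beta> :: nat \<Rightarrow> real ^ 'n)
      (\<phi> :: nat \<Rightarrow> real ^ 'n) (\<xi> :: nat \<Rightarrow> real ^ 'n) (\<gamma> :: nat \<Rightarrow> real ^ 'n).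
       w + (\<Sum>i\<in>{0..L}. (level L i - 1) * v i) \<le> (b - t) * (1 - \<epsilon>) \<and>
       (\<forall>i\<in>{0..L}. w - (\<Sum>j\<in>{0..i}. v j) \<ge> 0) \<and>
       (\<forall>i\<in>{0..L}. w - (\<Sum>j\<in>{0..i}. v j) + t \<ge>
          up i \<bullet> \<alpha> i - lo i \<bullet> \<beta> i + ahat \<bullet> (\<phi> i - \<xi> i) + dev i * (1 \<bullet> \<gamma> i)) \<and>
       (\<forall>i\<in>{0..L}. \<forall>j. \<alpha> i $ j - \<beta> i $ j + \<phi> i $ j - \<xi> i $ j = x $ j) \<and>
       (\<forall>i\<in>{0..L}. \<forall>j. \<gamma> i $ j - \<phi> i $ j - \<xi> i $ j \<ge> 0) \<and>
       (\<forall>i\<in>{0..L}. 0 \<le> \<alpha> i \<and> 0 \<le> \<beta> i \<and> 0 \<le> \<phi> i \<and> 0 \<le> \<xi> i \<and> 0 \<le> \<gamma> i) \<and>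
       (\<forall>i\<in>{0..L}. v i \<ge> 0))"
proof
  fix x assume "x \<in> X"
  let ?C = "confidence_set ahat adown aup D p q \<delta>"
  have level: "0 \<le> level L i" "level L i \<le> 1" if "i \<le> L" for i
    using that by (auto simp: level_def divide_le_eq_1)
  have \<delta>: "0 \<le> \<delta> a" for a
    by (simp add: \<delta>_def infnorm_pos_le)
  have C: "?C (level L i) = {a. lo i \<le> a \<and> a \<le> up i \<and> infnorm (a - ahat) \<le> dev i}" if "i \<le> L" for i
    using confidence_set_eq[of ahat adown aup p D q \<delta>, OF assms(7,8) \<delta> level[OF that]]
    by (simp add: lo_def up_def dev_def) (simp add: \<delta>_def)
  have center: "lo i \<le> ahat" "ahat \<le> up i" if "i \<le> L" for i
    using center_mem_cut[of ahat _ adown aup p "level L i"] assms(4,5,7) level[OF that]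
    by (auto simp: lo_def up_def less_eq_vec_def)
  have dev: "0 \<le> dev i" if "i \<le> L" for i
    using deviation_cut_nonneg[OF assms(8,6) level[OF that]] by (simp add: dev_def)
  have CVaR_iff: "(SUP P\<in>ambiguity_set L ?C. ereal (CVaR \<epsilon> P (\<lambda>a. a \<bullet> x))) \<le> ereal b \<longleftrightarrow>
    (\<exists>w t (v :: nat \<Rightarrow> real). w + (\<Sum>i\<in>{0..L}. (level L i - 1) * v i) \<le> (b - t) * (1 - \<epsilon>) \<and>
       (\<forall>i\<in>{0..L}. w - (\<Sum>j\<in>{0..i}. v j) \<ge> 0) \<and>
       (\<forall>i\<in>{0..L}. \<forall>a\<in>?C (level L i). a \<bullet> x \<le> w - (\<Sum>j\<in>{0..i}. v j) + t) \<and>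
       (\<forall>i\<in>{0..L}. v i \<ge> 0))"
  proof (rule SUP_CVaR_ambiguity_set_le_iff[OF assms(1-3)])
    show "compact (?C (level L i))" if "i \<le> L" for i
      using that by (simp add: C compact_box_infnorm)
    show "?C (level L i) \<noteq> {}" if "i \<le> L" for i
    proof -
      have "ahat \<in> ?C (level L i)"
        using that center dev by (simp add: C infnorm_0)
      then show ?thesis by blast
    qed
    show "?C (level L k) \<subseteq> ?C (level L i)" if "i \<le> k" "k \<le> L" for i k
      using that level[of i] level[of k] assms(7,8)
      by (intro confidence_set_antimono) (auto simp: level_def divide_right_mono)
  qed (intro continuous_intros)
  \<comment> \<open>Packing the dual constraints of one level into a single predicate lets
    \<open>bchoice_iff\<close> turn the multipliers found level by level into functions of
    \<open>i\<close>.\<close>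
  define Q where "Q i z \<alpha> \<beta> \<phi> \<xi> \<gamma> \<longleftrightarrow>
      up i \<bullet> \<alpha> - lo i \<bullet> \<beta> + ahat \<bullet> (\<phi> - \<xi>) + dev i * (1 \<bullet> \<gamma>) \<le> z \<and>
      (\<forall>j. \<alpha> $ j - \<beta> $ j + \<phi> $ j - \<xi> $ j = x $ j) \<and>
      (\<forall>j. \<gamma> $ j - \<phi> $ j - \<xi> $ j \<ge> 0) \<and>
      0 \<le> \<alpha> \<and> 0 \<le> \<beta> \<and> 0 \<le> \<phi> \<and> 0 \<le> \<xi> \<and> 0 \<le> \<gamma>" for i z \<alpha> \<beta> \<phi> \<xi> \<gamma>
  have "(\<forall>a\<in>?C (level L i). a \<bullet> x \<le> z) \<longleftrightarrow> (\<exists>\<alpha> \<beta> \<phi> \<xi> \<gamma>. Q i z \<alpha> \<beta> \<phi> \<xi> \<gamma>)"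
    if "i \<in> {0..L}" for i z
    using box_infnorm_lp_duality[OF center dev, of i i i x z] that by (simp add: C Q_def)
  then have "(\<forall>i\<in>{0..L}. \<forall>a\<in>?C (level L i). a \<bullet> x \<le> z i) \<longleftrightarrow>
      (\<forall>i\<in>{0..L}. \<exists>\<alpha> \<beta> \<phi> \<xi> \<gamma>. Q i (z i) \<alpha> \<beta> \<phi> \<xi> \<gamma>)" for z
    by (intro ball_cong) auto
  then have dual: "(\<forall>i\<in>{0..L}. \<forall>a\<in>?C (level L i). a \<bullet> x \<le> z i) \<longleftrightarrow>
      (\<exists>\<alpha> \<beta> \<phi> \<xi> \<gamma>. \<forall>i\<in>{0..L}. Q i (z i) (\<alpha> i) (\<beta> i) (\<phi> i) (\<xi> i) (\<gamma> i))" for z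
    by (simp only: bchoice_iff)
  show "(SUP P\<in>ambiguity_set L ?C. ereal (CVaR \<epsilon> P (\<lambda>a. a \<bullet> x))) \<le> ereal b \<longleftrightarrow>
    (\<exists>w t v \<alpha> \<beta> \<phi> \<xi> \<gamma>.
       w + (\<Sum>i\<in>{0..L}. (level L i - 1) * v i) \<le> (b - t) * (1 - \<epsilon>) \<and>
       (\<forall>i\<in>{0..L}. w - (\<Sum>j\<in>{0..i}. v j) \<ge> 0) \<and>
       (\<forall>i\<in>{0..L}. w - (\<Sum>j\<in>{0..i}. v j) + t \<ge>
          up i \<bullet> \<alpha> i - lo i \<bullet> \<beta> i + ahat \<bullet> (\<phi> i - \<xi> i) + dev i * (1 \<bullet> \<gamma> i)) \<and>
       (\<forall>i\<in>{0..L}. \<forall>j. \<alpha> i $ j - \<beta> i $ j + \<phi> i $ j - \<xi> i $ j = x $ j) \<and>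
       (\<forall>i\<in>{0..L}. \<forall>j. \<gamma> i $ j - \<phi> i $ j - \<xi> i $ j \<ge> 0) \<and>
       (\<forall>i\<in>{0..L}. 0 \<le> \<alpha> i \<and> 0 \<le> \<beta> i \<and> 0 \<le> \<phi> i \<and> 0 \<le> \<xi> i \<and> 0 \<le> \<gamma> i) \<and>
       (\<forall>i\<in>{0..L}. v i \<ge> 0))"
    \<comment> \<open>What remains is a rearrangement: the conjunction is distributed over the
      levels, and the existential quantifiers of the dual variables move to the front.\<close>
    unfolding CVaR_iff dual Q_def ball_conj_distrib
    by (simp only: ex_simps(1,2)[symmetric] conj_assoc)
qed

end
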